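(* Let $p>0$. The objective functions associated with the Optimal Problem, $$f(\mathbf{x}) = -\log\det(X(\mathbf{x})),\quad g(\mathbf{x}) = \operatorname{Tr}\left(X(\mathbf{x})^{-p}\right),\quad k(\mathbf{x}) = \log\left(\operatorname{Tr}\left(X(\mathbf{x})^{-p}\right)\right),$$ and with the Fusion Problem, $$f_F(\mathbf{x}) = -\log\det(X_C(\mathbf{x})),\quad g_F(\mathbf{x}) = \operatorname{Tr}\left(X_C(\mathbf{x})^{-p}\right),\quad k_F(\mathbf{x}) = \log\left(\operatorname{Tr}\left(X_C(\mathbf{x})^{-p}\right)\right),$$ are each $(c, 1/2)$-sharp for some $c > 0$ on $$\mathcal{W} := \operatorname{conv}\left( \mathcal{P} \cap D \cap \mathbb{N}_0^m \right).$$
   Context: $A\in\mathbb{R}^{m\times n}$ is a matrix with rows $\mathbf{v}_1,\dots,\mathbf{v}_m\in\mathbb{R}^n$ and full column rank. $\mathbf{l}\le\mathbf{u}$ in $\mathbb{N}_0^m$ are lower and upper bounds, $N$ is a positive integer, and $\mathcal{P} := [\mathbf{l},\mathbf{u}]\cap\{\mathbf{x}\in\mathbb{R}^m_{\ge 0} : \sum_{i=1}^m x_i = N\}$. The information matrix is $X(\mathbf{x}) := A^\intercal\operatorname{diag}(\mathbf{x})A$ and $D:=\{\mathbf{x}\in\mathbb{R}^m_{\ge0} : X(\mathbf{x})\text{ is positive definite}\}$. In the Optimal Problem $\mathbf{l}=0$. In the Fusion Problem, $n$ linearly independent rows of $A$ have non-zero lower bounds, $C:=A^\intercal\operatorname{diag}(\mathbf{l})A$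 (which is positive definite), and $X_C(\mathbf{x}):=C+A^\intercal\operatorname{diag}(\mathbf{x}-\mathbf{l})A$, which replaces $X(\mathbf{x})$. Real powers of positive definite matrices are defined through the eigendecomposition. Sharpness: let $\mathcal{X}$ be a compact convex set. A convex function $h$ is $(c,\theta)$-sharp over $\mathcal{X}$, with $0<c<\infty$ and $0<\theta<1$, if for all $\mathbf{x}\in\mathcal{X}$ and all $\mathbf{x}^*\in\Omega^*_{\mathcal{X}}$, $$c\,(h(\mathbf{x})-h(\mathbf{x}^* ))^\theta\ge\min_{\mathbf{y}\in\Omega^*_{\mathcal{X}}}\|\mathbf{x}-\mathbf{y}\|,$$ where $\Omega^*_{\mathcal{X}}$ is the set of minimizers of $h$ over $\mathcal{X}$ and the norm is Euclidean. *)

theory Defs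
  imports "HOL-Analysis.Analysis"
begin

definition diag :: "real^'n \<Rightarrow> real^'n^'n" where
  "diag v = (\<chi> i j. if i = j then v $ i else 0)"

definition pos_def :: "real^'n^'n \<Rightarrow> bool" where
  "pos_def M \<longleftrightarrow> transpose M = M \<and> (\<forall>x. x \<noteq> 0 \<longrightarrow> 0 < x \<bullet> (M *v x))"

text \<open>Real powers via an eigendecomposition \<open>M = Q diag(d) Q\<^sup>T\<close>. The result does not depend on
  the decomposition chosen, see \<open>matrix_powr_eigendecomposition\<close> below. The value is only
  meaningful for positive definite \<open>M\<close>, where all \<open>d $ i\<close> are positive.\<close>

definition matrix_powr :: "real^'n^'n \<Rightarrow> real \<Rightarrow> real^'n^'n" where
  "matrix_powr M q = (SOME Y. \<exists>Q d. orthogonal_matrix Q \<and> M = Q ** diag d ** transpose Q \<and>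
     Y = Q ** diag (\<chi> i. d $ i powr q) ** transpose Q)"

lemma matrix_mult_diag_nth: "(M ** diag d) $ i $ j = M $ i $ j * d $ j"
  by (simp add: matrix_matrix_mult_def diag_def if_distrib[of "\<lambda>z. _ * z"] cong: if_cong)

lemma diag_mult_matrix_nth: "(diag d ** M) $ i $ j = d $ i * M $ i $ j"
  by (simp add: matrix_matrix_mult_def diag_def if_distrib[of "\<lambda>z. z * _"] cong: if_cong)

lemma eigendecomposition_unique:
  fixes P Q :: "real^'n^'n"
  assumes P: "orthogonal_matrix P" and Q: "orthogonal_matrix Q"
    and eq: "P ** diag d ** transpose P = Q ** diag e ** transpose Q"
  shows "P ** diag (\<chi> i. f (d $ i)) ** transpose P = Q ** diag (\<chi> i. f (e $ i)) ** transpose Q"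
proof -
  define R where "R = transpose Q ** P"
  have PP: "transpose P ** P = mat 1" "P ** transpose P = mat 1"
    and QQ: "transpose Q ** Q = mat 1" "Q ** transpose Q = mat 1"
    using P Q by (auto simp: orthogonal_matrix_def)
  have "R ** diag d = transpose Q ** (P ** diag d ** transpose P) ** P"
    by (metis R_def PP(1) matrix_mul_assoc matrix_mul_rid)
  also have "\<dots> = diag e ** R"
    unfolding eq by (metis R_def QQ(1) matrix_mul_assoc matrix_mul_lid)
  finally have "R ** diag d = diag e ** R" .
  then have "R $ i $ j * d $ j = e $ i * R $ i $ j" for i j
    by (metis matrix_mult_diag_nth diag_mult_matrix_nth)
  then have "R $ i $ j = 0 \<or> d $ j = e $ i" for i j
    by (metis mult.commute mult_cancel_left)
  then have "R $ i $ j * f (d $ j) = f (e $ i) * R $ i $ j" for i j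
    by (metis mult.commute mult_zero_left)
  then have "R ** diag (\<chi> i. f (d $ i)) = diag (\<chi> i. f (e $ i)) ** R"
    by (simp add: vec_eq_iff matrix_mult_diag_nth diag_mult_matrix_nth)
  then have "Q ** (R ** diag (\<chi> i. f (d $ i))) ** transpose P
      = Q ** (diag (\<chi> i. f (e $ i)) ** R) ** transpose P"
    by simp
  moreover have "Q ** R = P" "R ** transpose P = transpose Q"
    by (metis R_def QQ(2) matrix_mul_assoc matrix_mul_lid)
       (metis R_def PP(2) matrix_mul_assoc matrix_mul_rid)
  ultimately show ?thesis
    by (metis matrix_mul_assoc)
qed

lemma matrix_powr_eigendecomposition:
  assumes "orthogonal_matrix Q"
  shows "matrix_powr (Q ** diag d ** transpose Q) q
    = Q ** diag (\<chi> i. d $ i powr q) ** transpose Q"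
  unfolding matrix_powr_def
  by (rule some_equality)
     (use assms in \<open>auto intro!: eigendecomposition_unique[where f = "\<lambda>x. x powr q"]\<close>)

definition info_matrix :: "real^'n^'m \<Rightarrow> real^'m \<Rightarrow> real^'n^'n" where
  "info_matrix A x = transpose A ** diag x ** A"

definition fusion_info_matrix :: "real^'n^'m \<Rightarrow> real^'m \<Rightarrow> real^'m \<Rightarrow> real^'n^'n" where
  "fusion_info_matrix A l x = info_matrix A l + transpose A ** diag (x - l) ** A"

definition nat_vecs :: "(real^'m) set" where
  "nat_vecs = {x. \<forall>i. x $ i \<in> \<nat>}"

definition design_polytope :: "real^'m \<Rightarrow> real^'m \<Rightarrow> nat \<Rightarrow> (real^'m) set" where
  "design_polytope l u N = {l..u} \<inter> {x. (\<forall>i. 0 \<le> x $ i) \<and> (\<Sum>i\<in>UNIV. x $ i) = real N}"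

definition info_domain :: "real^'n^'m \<Rightarrow> (real^'m) set" where
  "info_domain A = {x. (\<forall>i. 0 \<le> x $ i) \<and> pos_def (info_matrix A x)}"

definition feasible_hull :: "real^'n^'m \<Rightarrow> real^'m \<Rightarrow> real^'m \<Rightarrow> nat \<Rightarrow> (real^'m) set" where
  "feasible_hull A l u N = convex hull (design_polytope l u N \<inter> info_domain A \<inter> nat_vecs)"

definition fusion_bounds :: "real^'n^'m \<Rightarrow> real^'m \<Rightarrow> bool" where
  "fusion_bounds A l \<longleftrightarrow> (\<exists>I. card I = CARD('n) \<and> inj_on (\<lambda>i. row i A) I \<and>
     independent ((\<lambda>i. row i A) ` I) \<and> (\<forall>i\<in>I. l $ i \<noteq> 0))"

definition minimizers :: "'a set \<Rightarrow> ('a \<Rightarrow> real) \<Rightarrow> 'a set" where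
  "minimizers X h = {x \<in> X. \<forall>y\<in>X. h x \<le> h y}"

text \<open>The standing assumptions (compact convex domain, convex function) are part of the predicate,
  and the minimum distance to the set of minimizers is required to be attained.\<close>

definition sharp_on :: "'a::euclidean_space set \<Rightarrow> ('a \<Rightarrow> real) \<Rightarrow> real \<Rightarrow> real \<Rightarrow> bool" where
  "sharp_on X h c \<theta> \<longleftrightarrow> compact X \<and> convex X \<and> convex_on X h \<and> 0 < c \<and> 0 < \<theta> \<and> \<theta> < 1 \<and>
     (\<forall>x\<in>X. \<forall>x'\<in>minimizers X h.
        \<exists>y. is_arg_min (\<lambda>y. norm (x - y)) (\<lambda>y. y \<in> minimizers X h) y \<and>
            norm (x - y) \<le> c * (h x - h x') powr \<theta>)"

end

theory Submission
  imports Defs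
begin

text \<open>Both information matrices coincide and depend linearly on \<open>x\<close>, so every objective has the
  form \<open>h = \<phi> \<circ> X\<close> with \<open>X\<close> linear, on a polytope where \<open>X\<close> is positive definite and bounded.
  If \<open>\<phi>\<close> is strongly convex there, then \<open>h x - h x\<^sup>*\<close> dominates a multiple of
  \<open>norm (X x - X x\<^sup>*)\<^sup>2\<close> and the minimizers are the points of the polytope with \<open>X y = X x\<^sup>*\<close>.
  Hoffman's error bound then controls the distance to them by \<open>norm (X x - X x\<^sup>*)\<close>.

  Strong convexity comes from Klein's inequality: expanding in eigenbases of \<open>A\<close> and \<open>B\<close> reduces
  it to the scalar strong concavity of \<open>ln\<close> at pairs of eigenvalues. For \<open>ln (Tr X\<^sup>-\<^sup>p)\<close> the
  same scalar inequality is used with weights proportional to the \<open>-p\<close>-th powers of the eigenvalues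
  of \<open>A\<close>, after Jensen's inequality for \<open>ln\<close>; the case of \<open>Tr X\<^sup>-\<^sup>p\<close> follows from
  \<open>T - S \<ge> S * ln (T / S)\<close>.\<close>

subsection \<open>Error bounds and sharpness on polytopes\<close>

text \<open>Project \<open>x\<close> onto the fibre of \<open>L\<close> through \<open>x'\<close>. The displacement \<open>d\<close> lies in the cone of
  directions feasible for the constraints active at the projection, and in the polar of that cone's
  intersection with the kernel of \<open>L\<close>. These closed cones \<open>E I\<close> meet the kernel only in \<open>0\<close>, and
  there are finitely many of them.\<close>

lemma polyhedron_error_bound:
  fixes L :: "'a::euclidean_space \<Rightarrow> 'b::real_normed_vector"
  assumes "polyhedron W" and lin: "linear L"
  obtains C where "C > 0"
    and "\<And>x x'. \<lbrakk>x \<in> W; x' \<in> W\<rbrakk> \<Longrightarrow> \<exists>y. is_arg_min (\<lambda>y. norm (x - y)) (\<lambda>y. y \<in> W \<and> L y = L x') y \<and>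
           norm (x - y) \<le> C * norm (L x - L x')"
proof -
  interpret L: linear L by fact
  have contL: "continuous_on S L" for S
    using lin linear_continuous_on linear_conv_bounded_linear by blast
  obtain H where "finite H" and W: "W = \<Inter>H"
    and "\<forall>h\<in>H. \<exists>a b. a \<noteq> 0 \<and> h = {x. a \<bullet> x \<le> b}"
    using \<open>polyhedron W\<close> unfolding polyhedron_def by blast
  then obtain a b where H: "\<And>h. h \<in> H \<Longrightarrow> h = {x. a h \<bullet> x \<le> b h}"
    by metis
  define K where "K I = {d. \<forall>h\<in>I. a h \<bullet> d \<le> 0}" for I
  define E where "E I = {d \<in> K I. \<forall>z\<in>K I. L z = 0 \<longrightarrow> d \<bullet> z \<le> 0}" for I
  \<comment> \<open>A kernel element of \<open>E I\<close> may be tested against itself, which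
    forces \<open>d = 0\<close>. So \<open>norm (L d)\<close> is positive on the compact unit slice
    of the closed cone \<open>E I\<close>; its minimum there serves as \<open>k\<close>, and
    homogeneity extends the bound to the whole cone.\<close>
  have "\<exists>k>0. \<forall>d\<in>E I. k * norm d \<le> norm (L d)" for I
  proof -
    define S where "S = E I \<inter> sphere 0 1"
    have "E I = (\<Inter>h\<in>I. {d. a h \<bullet> d \<le> 0}) \<inter> (\<Inter>z\<in>{z \<in> K I. L z = 0}. {d. z \<bullet> d \<le> 0})"
      by (auto simp: E_def K_def inner_commute)
    then have "closed (E I)"
      by (simp add: closed_INT closed_Int closed_halfspace_le)
    then have "compact S"
      by (simp add: S_def closed_Int_compact)
    have pos: "0 < norm (L d)" if "d \<in> S" for d
    proof -
      have "d \<bullet> d \<le> 0" if "L d = 0"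
        using \<open>d \<in> S\<close> that by (auto simp: S_def E_def)
      moreover have "d \<noteq> 0"
        using \<open>d \<in> S\<close> by (auto simp: S_def)
      ultimately show ?thesis
        by (metis inner_gt_zero_iff not_le zero_less_norm_iff)
    qed
    obtain k where "k > 0" and k: "\<And>d. d \<in> S \<Longrightarrow> k \<le> norm (L d)"
    proof (cases "S = {}")
      case True
      then show ?thesis
        using that[of 1] by auto
    next
      case False
      obtain d where "d \<in> S" "\<forall>d'\<in>S. norm (L d) \<le> norm (L d')"
        using continuous_attains_inf[OF \<open>compact S\<close> False continuous_on_norm[OF contL]] by blast
      then show ?thesis
        using that[of "norm (L d)"] pos by auto
    qed
    have "k * norm d \<le> norm (L d)" if "d \<in> E I" for d
    proof (cases "d = 0")
      case False
      have "(1 / norm d) *\<^sub>R d \<in> S"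
        using that False by (auto simp: S_def E_def K_def divide_nonpos_pos)
      from k[OF this] show ?thesis
        using False by (simp add: L.scale field_simps)
    qed simp
    with \<open>k > 0\<close> show ?thesis by blast
  qed
  then obtain k where kpos: "\<And>I. k I > 0" and k: "\<And>I d. d \<in> E I \<Longrightarrow> k I * norm d \<le> norm (L d)"
    by metis
  \<comment> \<open>Which constraints are active varies with the point. Summing over all subsets of
    \<open>H\<close> is a crude way to dominate every \<open>1 / k I\<close> by one
    constant.\<close>
  define C where "C = (\<Sum>I\<in>Pow H. 1 / k I)"
  have C: "1 / k I \<le> C" if "I \<subseteq> H" for I
    unfolding C_def using that \<open>finite H\<close> kpos by (intro member_le_sum) (auto simp: less_imp_le)
  then have "C > 0"
    using kpos[of "{}"] by (smt (verit) empty_subsetI zero_less_divide_1_iff)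
  moreover have "\<exists>y. is_arg_min (\<lambda>y. norm (x - y)) (\<lambda>y. y \<in> W \<and> L y = L x') y \<and>
           norm (x - y) \<le> C * norm (L x - L x')" if "x \<in> W" "x' \<in> W" for x x'
  proof -
    let ?F = "{y \<in> W. L y = L x'}"
    have "?F = W \<inter> L -` {L x'}" by auto
    moreover have "closed (L -` {L x'})"
      by (simp add: closed_vimage contL)
    ultimately have "closed ?F"
      using polyhedron_imp_closed[OF \<open>polyhedron W\<close>] by auto
    moreover have "?F \<noteq> {}" using that by blast
    ultimately obtain y where y: "y \<in> ?F" and near: "\<And>w. w \<in> ?F \<Longrightarrow> dist x y \<le> dist x w"
      using distance_attains_inf[of ?F x] by blast
    define d where "d = x - y"
    define I where "I = {h \<in> H. a h \<bullet> y = b h}"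
    have ineq: "a h \<bullet> w \<le> b h" if "w \<in> W" "h \<in> H" for w h
      using that H[of h] W by blast
    have inW: "w \<in> W" if "\<And>h. h \<in> H \<Longrightarrow> a h \<bullet> w \<le> b h" for w
      using that H W by blast
    have "d \<in> K I"
      using ineq[OF \<open>x \<in> W\<close>] by (auto simp: K_def I_def d_def inner_diff_right)
    \<comment> \<open>Otherwise a short step from \<open>y\<close> along \<open>z\<close> stays in
      the fibre: active constraints do not increase and inactive ones have slack. The condition
      \<open>t * (z \<bullet> z) < 2 * (d \<bullet> z)\<close> says exactly that the step brings the
      point closer to \<open>x\<close>, contradicting the choice of \<open>y\<close>.\<close>
    moreover have "d \<bullet> z \<le> 0" if z: "z \<in> K I" "L z = 0" for z
    proof (rule ccontr)
      assume "\<not> d \<bullet> z \<le> 0"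
      then have dz: "d \<bullet> z > 0" by simp
      have "\<forall>\<^sub>F t in at_right (0::real). a h \<bullet> (y + t *\<^sub>R z) \<le> b h" if "h \<in> H" for h
      proof (cases "h \<in> I")
        case True
        have "a h \<bullet> (y + t *\<^sub>R z) \<le> b h" if "t > 0" for t
          using True z that by (auto simp: K_def I_def inner_add_right mult_nonneg_nonpos)
        then show ?thesis
          by (auto simp: eventually_at_right_field intro: exI[of _ 1])
      next
        case False
        then have "a h \<bullet> y < b h"
          using ineq[of y h] y that unfolding I_def by force
        moreover have "((\<lambda>t. a h \<bullet> (y + t *\<^sub>R z)) \<longlongrightarrow> a h \<bullet> (y + 0 *\<^sub>R z)) (at_right 0)"
          by (intro tendsto_intros)
        ultimately have "\<forall>\<^sub>F t in at_right 0. a h \<bullet> (y + t *\<^sub>R z) < b h"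
          by (simp add: order_tendsto_iff)
        then show ?thesis
          by (rule eventually_mono) simp
      qed
      then have "\<forall>\<^sub>F t in at_right (0::real). \<forall>h\<in>H. a h \<bullet> (y + t *\<^sub>R z) \<le> b h"
        by (simp add: eventually_ball_finite_distrib \<open>finite H\<close>)
      moreover have "((\<lambda>t. t * (z \<bullet> z)) \<longlongrightarrow> 0 * (z \<bullet> z)) (at_right 0)"
        by (intro tendsto_intros)
      then have "\<forall>\<^sub>F t in at_right 0. t * (z \<bullet> z) < 2 * (d \<bullet> z)"
        using dz by (simp add: order_tendsto_iff)
      moreover have "\<forall>\<^sub>F t in at_right (0::real). 0 < t"
        by (rule eventually_at_right_less)
      ultimately have "\<forall>\<^sub>F t in at_right (0::real). (\<forall>h\<in>H. a h \<bullet> (y + t *\<^sub>R z) \<le> b h) \<and>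
          t * (z \<bullet> z) < 2 * (d \<bullet> z) \<and> 0 < t"
        by eventually_elim blast
      from eventually_happens'[OF _ this] obtain t where
        t: "\<forall>h\<in>H. a h \<bullet> (y + t *\<^sub>R z) \<le> b h" "t * (z \<bullet> z) < 2 * (d \<bullet> z)" "0 < t"
        by auto
      have "y + t *\<^sub>R z \<in> ?F"
        using inW[of "y + t *\<^sub>R z"] t(1) y z(2) by (simp add: L.add L.scale)
      then have "dist x y \<le> dist x (y + t *\<^sub>R z)" by (rule near)
      then have "norm d \<le> norm (d - t *\<^sub>R z)"
        by (simp add: d_def dist_norm algebra_simps)
      then have "d \<bullet> d \<le> (d - t *\<^sub>R z) \<bullet> (d - t *\<^sub>R z)"
        by (simp add: norm_le)
      then have "t * (2 * (d \<bullet> z)) \<le> t * (t * (z \<bullet> z))"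
        by (simp add: inner_diff_left inner_diff_right inner_commute algebra_simps)
      with t show False by simp
    qed
    ultimately have "d \<in> E I" by (simp add: E_def)
    then have "k I * norm d \<le> norm (L d)" by (rule k)
    then have "norm d \<le> 1 / k I * norm (L d)"
      using kpos[of I] by (simp add: field_simps)
    also have "\<dots> \<le> C * norm (L d)"
      using C[of I] by (intro mult_right_mono) (auto simp: I_def)
    also have "L d = L x - L x'"
      using y by (simp add: d_def L.diff)
    finally have "norm (x - y) \<le> C * norm (L x - L x')"
      by (simp add: d_def)
    moreover have "is_arg_min (\<lambda>y. norm (x - y)) (\<lambda>y. y \<in> W \<and> L y = L x') y"
      using y near unfolding is_arg_min_def dist_norm by (auto simp: not_less)
    ultimately show ?thesis by blast
  qed
  ultimately show ?thesis using that by blast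
qed

text \<open>The hypothesis gives some quadratic lower support at each point, but at a minimizer its
  \<open>g\<close> need not satisfy the first-order optimality condition. Growth away from the
  minimizers is therefore derived from the supports at midpoints.\<close>

lemma sharp_on_half:
  fixes L :: "'a::euclidean_space \<Rightarrow> 'b::real_inner"
  assumes "polytope W" and lin: "linear L" and "\<kappa> > 0"
    and sub: "\<And>x. x \<in> W \<Longrightarrow> \<exists>g. \<forall>y\<in>W. h x + g \<bullet> (L y - L x) + \<kappa> * (norm (L y - L x))\<^sup>2 \<le> h y"
  shows "convex_on W h" and "\<exists>c>0. sharp_on W h c (1/2)"
proof -
  interpret L: linear L by fact
  have "convex W" "compact W" "polyhedron W"
    using \<open>polytope W\<close> by (auto simp: polytope_imp_convex polytope_imp_compact polytope_imp_polyhedron)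
  show conv: "convex_on W h"
  proof (rule convex_onI)
    fix t :: real and x y
    assume t: "0 < t" "t < 1" and xy: "x \<in> W" "y \<in> W"
    \<comment> \<open>In the weighted sum of the supporting inequalities at \<open>z\<close>, the
      linear terms cancel.\<close>
    define z where "z = (1 - t) *\<^sub>R x + t *\<^sub>R y"
    have "z \<in> W"
      using \<open>convex W\<close> xy t by (simp add: z_def convexD_alt)
    then obtain g where g: "\<forall>y\<in>W. h z + g \<bullet> (L y - L z) + \<kappa> * (norm (L y - L z))\<^sup>2 \<le> h y"
      using sub by blast
    have g': "h z + g \<bullet> (L w - L z) \<le> h w" if "w \<in> W" for w
      using g that \<open>\<kappa> > 0\<close> by (smt (verit) mult_nonneg_nonneg zero_le_power2)
    have Lz: "L z = (1 - t) *\<^sub>R L x + t *\<^sub>R L y"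
      by (simp only: z_def L.add L.scale)
    have "h z = (1 - t) * (h z + g \<bullet> (L x - L z)) + t * (h z + g \<bullet> (L y - L z))"
      by (simp add: Lz inner_diff_right inner_add_right algebra_simps)
    also have "\<dots> \<le> (1 - t) * h x + t * h y"
      using g' xy t by (intro add_mono mult_left_mono) auto
    finally show "h ((1 - t) *\<^sub>R x + t *\<^sub>R y) \<le> (1 - t) * h x + t * h y"
      by (simp add: z_def)
  qed fact
  obtain C where "C > 0" and C: "\<And>x x'. \<lbrakk>x \<in> W; x' \<in> W\<rbrakk> \<Longrightarrow>
      \<exists>y. is_arg_min (\<lambda>y. norm (x - y)) (\<lambda>y. y \<in> W \<and> L y = L x') y \<and>
           norm (x - y) \<le> C * norm (L x - L x')"
    using polyhedron_error_bound[OF \<open>polyhedron W\<close> lin] by blast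
  define c where "c = C * sqrt (2 / \<kappa>)"
  have "c > 0" using \<open>C > 0\<close> \<open>\<kappa> > 0\<close> by (simp add: c_def)
  moreover have "\<exists>y. is_arg_min (\<lambda>y. norm (x - y)) (\<lambda>y. y \<in> minimizers W h) y \<and>
            norm (x - y) \<le> c * (h x - h x') powr (1/2)"
    if x: "x \<in> W" and x': "x' \<in> minimizers W h" for x x'
  proof -
    have x'W: "x' \<in> W" and min: "\<And>w. w \<in> W \<Longrightarrow> h x' \<le> h w"
      using x' by (auto simp: minimizers_def)
    \<comment> \<open>Adding the support at the midpoint \<open>z\<close>, evaluated at
      \<open>w\<close> and at \<open>x'\<close>, cancels \<open>g\<close> and leaves two quadratic
      terms with factor \<open>\<kappa> / 4\<close>. Minimality replaces \<open>h z\<close> by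
      \<open>h x'\<close>.\<close>
    have growth: "\<kappa> / 2 * (norm (L w - L x'))\<^sup>2 \<le> h w - h x'" if "w \<in> W" for w
    proof -
      define z where "z = (1/2) *\<^sub>R (w + x')"
      have z: "z = (1 - 1/2) *\<^sub>R w + (1/2) *\<^sub>R x'"
        by (simp add: z_def algebra_simps)
      have "z \<in> W"
        using convexD_alt[OF \<open>convex W\<close> that x'W, of "1/2"] by (simp only: z)
      then obtain g where g: "\<forall>y\<in>W. h z + g \<bullet> (L y - L z) + \<kappa> * (norm (L y - L z))\<^sup>2 \<le> h y"
        using sub by blast
      have Lz: "L w - L z = (1/2) *\<^sub>R (L w - L x')" "L x' - L z = - (1/2) *\<^sub>R (L w - L x')"
        by (simp_all add: z L.add L.scale L.diff algebra_simps flip: scaleR_add_left)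
      have "h z + g \<bullet> (L w - L z) + \<kappa> * (norm (L w - L z))\<^sup>2 \<le> h w"
        "h z + g \<bullet> (L x' - L z) + \<kappa> * (norm (L x' - L z))\<^sup>2 \<le> h x'"
        using g that x'W by auto
      moreover have "h x' \<le> h z" using min \<open>z \<in> W\<close> by blast
      ultimately show ?thesis
        unfolding Lz by (simp add: power_divide)
    qed
    \<comment> \<open>Growth forces all minimizers into one fibre of \<open>L\<close>. Conversely,
      in the support at \<open>w\<close> evaluated at \<open>x'\<close>, both correction terms
      vanish if \<open>L w = L x'\<close>. The error bound for the fibre is thus one for the set of
      minimizers.\<close>
    have eq: "w \<in> minimizers W h \<longleftrightarrow> w \<in> W \<and> L w = L x'" for w
    proof
      assume w: "w \<in> minimizers W h"
      then have "h w \<le> h x'" "w \<in> W"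
        using x'W by (auto simp: minimizers_def)
      then have "\<kappa> / 2 * (norm (L w - L x'))\<^sup>2 \<le> 0"
        using growth[of w] by simp
      then show "w \<in> W \<and> L w = L x'"
        using \<open>\<kappa> > 0\<close> \<open>w \<in> W\<close> by (simp add: mult_le_0_iff)
    next
      assume w: "w \<in> W \<and> L w = L x'"
      then obtain g where "\<forall>y\<in>W. h w + g \<bullet> (L y - L w) + \<kappa> * (norm (L y - L w))\<^sup>2 \<le> h y"
        using sub by blast
      then have "h w \<le> h x'"
        using x'W w by force
      with w min show "w \<in> minimizers W h"
        by (force simp: minimizers_def)
    qed
    obtain y where y: "is_arg_min (\<lambda>y. norm (x - y)) (\<lambda>y. y \<in> W \<and> L y = L x') y"
      and le: "norm (x - y) \<le> C * norm (L x - L x')"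
      using C[OF x x'W] by blast
    have "(norm (L x - L x'))\<^sup>2 \<le> 2 / \<kappa> * (h x - h x')"
      using growth[OF x] \<open>\<kappa> > 0\<close> by (simp add: field_simps)
    then have "norm (L x - L x') \<le> sqrt (2 / \<kappa>) * sqrt (h x - h x')"
      using real_le_rsqrt by (fastforce simp flip: real_sqrt_mult)
    then have "norm (x - y) \<le> C * (sqrt (2 / \<kappa>) * sqrt (h x - h x'))"
      using le \<open>C > 0\<close> by (meson mult_left_mono order_trans less_imp_le)
    then have "norm (x - y) \<le> c * (h x - h x') powr (1/2)"
      using min[OF x] by (simp add: c_def powr_half_sqrt mult.assoc)
    then show ?thesis
      using y unfolding eq by blast
  qed
  ultimately have "sharp_on W h c (1/2)"
    using conv \<open>compact W\<close> \<open>convex W\<close> by (simp add: sharp_on_def)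
  with \<open>c > 0\<close> show "\<exists>c>0. sharp_on W h c (1/2)" by blast
qed

subsection \<open>The spectral theorem\<close>

lemma symmetric_matrix_inner:
  fixes M :: "real^'n^'n"
  assumes "transpose M = M"
  shows "x \<bullet> (M *v y) = (M *v x) \<bullet> y"
  by (metis assms dot_lmul_matrix vector_transpose_matrix)

text \<open>A maximiser of the Rayleigh quotient on an invariant subspace is an eigenvector.\<close>

lemma symmetric_matrix_eigenvector:
  fixes M :: "real^'n^'n"
  assumes sym: "transpose M = M" and S: "subspace S" "S \<noteq> {0}"
    and inv: "\<And>x. x \<in> S \<Longrightarrow> M *v x \<in> S"
  obtains v r where "v \<in> S" "norm v = 1" "M *v v = r *\<^sub>R v"
proof -
  have "0 \<in> S" using S(1) by (rule subspace_0)
  then obtain x where "x \<in> S" "x \<noteq> 0" using S(2) by blast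
  then have "(1 / norm x) *\<^sub>R x \<in> S \<inter> sphere 0 1"
    using S(1) by (simp add: subspace_scale)
  then have "S \<inter> sphere 0 1 \<noteq> {}" by blast
  moreover have "compact (S \<inter> sphere 0 1)"
    using closed_subspace[OF S(1)] by (simp add: closed_Int_compact)
  moreover have "continuous_on (S \<inter> sphere 0 1) (\<lambda>x. x \<bullet> (M *v x))"
    by (intro continuous_intros)
  ultimately obtain v where v: "v \<in> S \<inter> sphere 0 1"
    and max: "\<And>y. y \<in> S \<inter> sphere 0 1 \<Longrightarrow> y \<bullet> (M *v y) \<le> v \<bullet> (M *v v)"
    using continuous_attains_sup by (metis (no_types, lifting))
  define r where "r = v \<bullet> (M *v v)"
  have vS: "v \<in> S" and nv: "norm v = 1" and vv: "v \<bullet> v = 1"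
    using v by (auto simp: dot_square_norm)
  have q: "w \<bullet> (M *v w) \<le> r * (w \<bullet> w)" if "w \<in> S" for w
  proof (cases "w = 0")
    case False
    have "(1 / norm w) *\<^sub>R w \<in> S \<inter> sphere 0 1"
      using False that S(1) by (simp add: subspace_scale)
    from max[OF this] show ?thesis
      using False unfolding r_def
      by (simp add: matrix_vector_mult_scaleR field_simps dot_square_norm power2_eq_square)
  qed simp
  \<comment> \<open>The residual \<open>w\<close> is orthogonal to \<open>v\<close>. Inserting
    \<open>v + t *\<^sub>R w\<close> into the Rayleigh bound cancels the constant terms and leaves
    \<open>main\<close>, where a linear term in \<open>t\<close> is dominated by a quadratic one;
    this is only possible for \<open>w = 0\<close>.\<close>
  define w where "w = M *v v - r *\<^sub>R v"
  have wS: "w \<in> S"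
    using inv vS S(1) by (simp add: w_def subspace_diff subspace_scale)
  have "v \<bullet> w = 0"
    using nv by (simp add: w_def inner_diff_right r_def dot_square_norm)
  moreover have "w \<bullet> (M *v v) = w \<bullet> w + r * (v \<bullet> w)"
    by (simp add: w_def inner_diff_right inner_diff_left inner_commute algebra_simps)
  ultimately have wv: "v \<bullet> w = 0" "w \<bullet> (M *v v) = w \<bullet> w" by auto
  have main: "2 * t * (w \<bullet> w) \<le> t\<^sup>2 * (r * (w \<bullet> w) - w \<bullet> (M *v w))" for t
  proof -
    have "v + t *\<^sub>R w \<in> S"
      using vS wS S(1) by (simp add: subspace_add subspace_scale)
    from q[OF this] show ?thesis
      using wv vv symmetric_matrix_inner[OF sym, of v w]
      by (simp add: matrix_vector_mult_scaleR matrix_vector_right_distrib inner_add_left inner_add_right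
          inner_commute r_def[symmetric] power2_eq_square algebra_simps)
  qed
  have "w \<bullet> w \<le> 0"
  proof (rule ccontr)
    assume "\<not> w \<bullet> w \<le> 0"
    then have ww: "w \<bullet> w > 0" by (simp only: not_le)
    define K where "K = r * (w \<bullet> w) - w \<bullet> (M *v w)"
    have "K \<ge> 0" using q[OF wS] by (simp add: K_def)
    \<comment> \<open>Adding 1 keeps the denominator positive if \<open>K = 0\<close>, and gives
      \<open>t * K \<le> w \<bullet> w\<close>, too small for \<open>main\<close>.\<close>
    define t where "t = w \<bullet> w / (K + 1)"
    have "t > 0" using ww \<open>K \<ge> 0\<close> by (simp add: t_def)
    have "t * (2 * (w \<bullet> w)) \<le> t * (t * K)"
      using main[of t] by (simp add: K_def power2_eq_square algebra_simps)
    then have "2 * (w \<bullet> w) \<le> t * K"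
      using \<open>t > 0\<close> by simp
    also have "\<dots> \<le> t * (K + 1)" using \<open>t > 0\<close> by simp
    also have "\<dots> = w \<bullet> w" using \<open>K \<ge> 0\<close> by (simp add: t_def)
    finally show False using ww by simp
  qed
  then have "w = 0"
    by (metis inner_gt_zero_iff not_le)
  then have "M *v v = r *\<^sub>R v"
    by (simp add: w_def)
  with vS nv show ?thesis using that by blast
qed

text \<open>Induction on the dimension: split off one unit eigenvector \<open>v\<close> and continue
  in its orthogonal complement within \<open>S\<close>, which is invariant because \<open>M\<close>
  is symmetric.\<close>

lemma symmetric_matrix_eigenbasis:
  fixes M :: "real^'n^'n"
  assumes sym: "transpose M = M" and "subspace S"
    and "\<And>x. x \<in> S \<Longrightarrow> M *v x \<in> S"
  shows "\<exists>B \<subseteq> S. pairwise orthogonal B \<and> (\<forall>b\<in>B. norm b = 1 \<and> (\<exists>r. M *v b = r *\<^sub>R b)) \<and> span B = S"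
  using assms(2,3)
proof (induction "dim S" arbitrary: S rule: less_induct)
  case less
  show ?case
  proof (cases "S = {0}")
    case True
    then show ?thesis by (intro exI[of _ "{}"]) auto
  next
    case False
    obtain v r where v: "v \<in> S" "norm v = 1" "M *v v = r *\<^sub>R v"
      using symmetric_matrix_eigenvector[OF sym less.prems(1) False less.prems(2)] by blast
    define T where "T = {x \<in> S. v \<bullet> x = 0}"
    have "v \<bullet> v = 1" using v(2) by (simp add: dot_square_norm)
    have T: "subspace T"
      using less.prems(1) by (auto simp: T_def subspace_def inner_add_right)
    have "v \<notin> T" using \<open>v \<bullet> v = 1\<close> by (simp add: T_def)
    moreover have "T \<subseteq> S" by (auto simp: T_def)
    ultimately have "T \<subset> S" using v(1) by blast
    then have "dim T < dim S"
      by (metis T less.prems(1) dim_psubset span_eq_iff)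
    moreover have "M *v x \<in> T" if "x \<in> T" for x
      using that less.prems(2) v(3) symmetric_matrix_inner[OF sym, of v x] by (simp add: T_def)
    ultimately obtain B where B: "B \<subseteq> T" "pairwise orthogonal B"
        "\<forall>b\<in>B. norm b = 1 \<and> (\<exists>r. M *v b = r *\<^sub>R b)" "span B = T"
      using less.hyps[of T] T by blast
    have "insert v B \<subseteq> S" using B(1) v(1) by (auto simp: T_def)
    moreover have "pairwise orthogonal (insert v B)"
      using B(1,2) by (auto simp: pairwise_insert orthogonal_def T_def inner_commute)
    moreover have "x \<in> span (insert v B)" if "x \<in> S" for x
    proof -
      have "x - (v \<bullet> x) *\<^sub>R v \<in> T"
        using that v(1) less.prems(1) \<open>v \<bullet> v = 1\<close>
        by (simp add: T_def subspace_diff subspace_scale inner_diff_right)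
      then show ?thesis
        using B(4) by (auto simp: span_insert)
    qed
    then have "span (insert v B) = S"
      using \<open>insert v B \<subseteq> S\<close> less.prems(1) span_minimal by blast
    ultimately show ?thesis
      using B(3) v by (intro exI[of _ "insert v B"]) blast
  qed
qed

lemma symmetric_matrix_eigendecomposition:
  fixes M :: "real^'n^'n"
  assumes "transpose M = M"
  obtains Q d where "orthogonal_matrix Q" "M = Q ** diag d ** transpose Q"
proof -
  obtain B :: "(real^'n) set" where B: "pairwise orthogonal B" "span B = UNIV"
    "\<forall>b\<in>B. norm b = 1" "\<forall>b\<in>B. \<exists>r. M *v b = r *\<^sub>R b"
    using symmetric_matrix_eigenbasis[OF assms, of UNIV] by auto
  then obtain ev where ev: "\<And>b. b \<in> B \<Longrightarrow> M *v b = ev b *\<^sub>R b" by metis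
  have "0 \<notin> B" using B(3) by force
  then have "independent B" using B(1) pairwise_orthogonal_independent by blast
  then have "card B = CARD('n)" and "finite B"
    using B(2) dim_eq_card[of B UNIV] by (auto simp: independent_imp_finite)
  then obtain f where f: "bij_betw f (UNIV :: 'n set) B"
    using finite_same_card_bij[of "UNIV :: 'n set" B] by auto
  have fB: "f i \<in> B" for i using f bij_betwE by blast
  define Q :: "real^'n^'n" where "Q = (\<chi> i j. f j $ i)"
  define d where "d = (\<chi> j. ev (f j))"
  have col: "column j Q = f j" for j by (simp add: Q_def column_def vec_eq_iff)
  have "orthogonal (f i) (f j)" if "i \<noteq> j" for i j
    using that f fB B(1) by (metis bij_betw_imp_inj_on injD pairwiseD)
  then have Q: "orthogonal_matrix Q"
    using fB B(3) by (simp add: orthogonal_matrix_orthonormal_columns col)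
  have "(M ** Q) $ i $ j = (M *v f j) $ i" for i j
    by (simp add: matrix_matrix_mult_def matrix_vector_mult_def Q_def)
  then have "M ** Q = Q ** diag d"
    by (simp add: vec_eq_iff ev[OF fB] matrix_mult_diag_nth d_def Q_def)
  then have "M = Q ** diag d ** transpose Q"
    using Q unfolding orthogonal_matrix_def by (metis matrix_mul_assoc matrix_mul_rid)
  with Q show ?thesis using that by blast
qed

subsection \<open>Pairs of eigenbases\<close>

lemma orthogonal_matrix_mult_transpose:
  fixes P :: "real^'n^'n"
  assumes "orthogonal_matrix P"
  shows "P ** transpose P = mat 1" "transpose P ** P = mat 1"
  using assms by (auto simp: orthogonal_matrix_def)

lemma inner_matrix_trace: "(X :: real^'n^'m) \<bullet> Y = trace (transpose X ** Y)"
  by (simp add: inner_vec_def trace_def matrix_matrix_mult_def transpose_def) (rule sum.swap)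

lemma inner_matrix_orthogonal_invariant:
  fixes X Y P Q :: "real^'n^'n"
  assumes P: "orthogonal_matrix P" and Q: "orthogonal_matrix Q"
  shows "(transpose P ** X ** Q) \<bullet> (transpose P ** Y ** Q) = X \<bullet> Y"
proof -
  have "(transpose P ** X ** Q) \<bullet> (transpose P ** Y ** Q)
      = trace (transpose Q ** (transpose X ** (P ** transpose P) ** Y ** Q))"
    by (simp add: inner_matrix_trace matrix_transpose_mul matrix_mul_assoc)
  also have "\<dots> = trace (transpose X ** Y ** (Q ** transpose Q))"
    by (subst trace_mul_sym) (simp add: orthogonal_matrix_mult_transpose[OF P] matrix_mul_assoc)
  finally show ?thesis
    by (simp add: orthogonal_matrix_mult_transpose[OF Q] inner_matrix_trace)
qed

lemma trace_eigendecomposition: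
  fixes P :: "real^'n^'n"
  assumes "orthogonal_matrix P"
  shows "trace (P ** diag d ** transpose P) = (\<Sum>i\<in>UNIV. d $ i)"
proof -
  have "trace (P ** diag d ** transpose P) = trace (transpose P ** P ** diag d)"
    by (subst trace_mul_sym) (simp add: matrix_mul_assoc)
  then show ?thesis
    by (simp add: orthogonal_matrix_mult_transpose[OF assms] trace_def diag_def)
qed

lemma det_eigendecomposition:
  fixes P :: "real^'n^'n"
  assumes "orthogonal_matrix P"
  shows "det (P ** diag d ** transpose P) = (\<Prod>i\<in>UNIV. d $ i)"
proof -
  have "det P * det (transpose P) = 1"
    using orthogonal_matrix_mult_transpose(1)[OF assms] by (metis det_I det_mul)
  moreover have "det (diag d) = (\<Prod>i\<in>UNIV. d $ i)"
    by (subst det_diagonal) (auto simp: diag_def)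
  ultimately show ?thesis by (simp add: det_mul algebra_simps)
qed

lemma diag_mult_vector_nth: "(diag d *v x) $ i = d $ i * x $ i"
  by (simp add: matrix_vector_mult_def diag_def if_distrib[of "\<lambda>z. z * _"] cong: if_cong)

lemma pos_def_eigenvalues_pos:
  fixes P :: "real^'n^'n"
  assumes P: "orthogonal_matrix P" and "pos_def (P ** diag d ** transpose P)"
  shows "0 < d $ i"
proof -
  define v where "v = P *v axis i 1"
  have "transpose P *v v = axis i 1"
    by (simp add: v_def matrix_vector_mul_assoc orthogonal_matrix_mult_transpose[OF P])
  moreover have "diag d *v axis i 1 = d $ i *\<^sub>R axis i 1"
    by (simp add: vec_eq_iff diag_mult_vector_nth axis_def)
  ultimately have "(P ** diag d ** transpose P) *v v = d $ i *\<^sub>R v"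
    by (simp add: matrix_vector_mul_assoc[symmetric] matrix_vector_mult_scaleR flip: v_def)
  moreover have "v \<noteq> 0"
    using \<open>transpose P *v v = axis i 1\<close> by (metis axis_eq_0_iff matrix_vector_mult_0_right zero_neq_one)
  ultimately have "0 < d $ i * (v \<bullet> v)"
    using assms(2) unfolding pos_def_def by (metis inner_scaleR_right)
  then show ?thesis
    using inner_ge_zero[of v] by (auto simp: zero_less_mult_iff)
qed

text \<open>The norm on \<open>real^'n^'n\<close> is the Frobenius norm, which conjugation by
  \<open>P\<close> preserves; hence it can be read off \<open>diag d\<close>, whose entries it
  bounds.\<close>

lemma norm_eigendecomposition:
  fixes P :: "real^'n^'n"
  assumes P: "orthogonal_matrix P"
  shows "\<bar>d $ i\<bar> \<le> norm (P ** diag d ** transpose P)"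
proof -
  have "transpose P ** (P ** diag d ** transpose P) ** P = diag d"
    using orthogonal_matrix_mult_transpose(2)[OF P]
    by (simp add: matrix_mul_assoc) (simp flip: matrix_mul_assoc)
  then have "norm (P ** diag d ** transpose P) = norm (diag d)"
    using inner_matrix_orthogonal_invariant[OF P P, of "P ** diag d ** transpose P" "P ** diag d ** transpose P"]
    by (simp add: norm_eq_sqrt_inner)
  moreover have "\<bar>diag d $ i $ i\<bar> \<le> norm (diag d)"
    by (rule order_trans[OF component_le_norm_cart Finite_Cartesian_Product.norm_nth_le])
  ultimately show ?thesis by (simp add: diag_def)
qed

lemma matrix_mult_diff_sandwich:
  fixes A :: "real^'m^'l" and B C :: "real^'n^'m" and D :: "real^'k^'n"
  shows "A ** (B - C) ** D = A ** B ** D - A ** C ** D"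
  by (simp add: vec_eq_iff matrix_matrix_mult_def algebra_simps sum_subtractf)

text \<open>The overlaps \<open>transpose P ** Q\<close> of two eigenbases turn Frobenius inner products of spectral
  functions into double sums over pairs of eigenvalues.\<close>

lemma
  fixes P Q :: "real^'n^'n" and a b e :: "real^'n"
  assumes P: "orthogonal_matrix P" and Q: "orthogonal_matrix Q"
  defines "c \<equiv> \<lambda>i j. ((transpose P ** Q) $ i $ j)\<^sup>2"
    and "M \<equiv> Q ** diag b ** transpose Q - P ** diag a ** transpose P"
  shows overlap_sum_row: "(\<Sum>j\<in>UNIV. c i j) = 1"
    and overlap_sum_column: "(\<Sum>i\<in>UNIV. c i j) = 1"
    and overlap_inner: "(P ** diag e ** transpose P) \<bullet> M
      = (\<Sum>i\<in>UNIV. \<Sum>j\<in>UNIV. c i j * e $ i * (b $ j - a $ i))"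
    and overlap_norm: "(norm M)\<^sup>2 = (\<Sum>i\<in>UNIV. \<Sum>j\<in>UNIV. c i j * (b $ j - a $ i)\<^sup>2)"
proof -
  define R where "R = transpose P ** Q"
  have R: "orthogonal_matrix R"
    using P Q by (simp add: R_def orthogonal_matrix_mul orthogonal_matrix_transpose)
  have "norm (row i R) = 1" "norm (column j R) = 1" for i j
    using R orthogonal_matrix_orthonormal_rows orthogonal_matrix_orthonormal_columns by blast+
  then show "(\<Sum>j\<in>UNIV. c i j) = 1" "(\<Sum>i\<in>UNIV. c i j) = 1"
    by (simp_all add: c_def norm_vec_def L2_set_def row_def column_def flip: R_def)
  have 1: "transpose P ** (P ** diag e ** transpose P) ** Q = diag e ** R" for e
    using orthogonal_matrix_mult_transpose(2)[OF P] by (simp add: R_def matrix_mul_assoc)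
  have 2: "transpose P ** (Q ** diag b ** transpose Q) ** Q = R ** diag b"
    using orthogonal_matrix_mult_transpose(2)[OF Q] by (simp add: R_def flip: matrix_mul_assoc)
  \<comment> \<open>Read in the basis \<open>P\<close> on the left and \<open>Q\<close> on the
    right, the difference has entries that are an overlap times a difference of eigenvalues.\<close>
  have M: "(transpose P ** M ** Q) $ i $ j = R $ i $ j * (b $ j - a $ i)" for i j
    unfolding M_def
    by (simp add: matrix_mult_diff_sandwich 1 2 matrix_mult_diag_nth diag_mult_matrix_nth algebra_simps)
  have "(P ** diag e ** transpose P) \<bullet> M = (diag e ** R) \<bullet> (transpose P ** M ** Q)"
    using inner_matrix_orthogonal_invariant[OF P Q, of "P ** diag e ** transpose P" M] by (simp add: 1)
  then show "(P ** diag e ** transpose P) \<bullet> M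
      = (\<Sum>i\<in>UNIV. \<Sum>j\<in>UNIV. c i j * e $ i * (b $ j - a $ i))"
    by (simp add: inner_vec_def M diag_mult_matrix_nth c_def power2_eq_square mult_ac flip: R_def)
  have "(norm M)\<^sup>2 = (transpose P ** M ** Q) \<bullet> (transpose P ** M ** Q)"
    by (simp add: power2_norm_eq_inner inner_matrix_orthogonal_invariant[OF P Q])
  then show "(norm M)\<^sup>2 = (\<Sum>i\<in>UNIV. \<Sum>j\<in>UNIV. c i j * (b $ j - a $ i)\<^sup>2)"
    by (simp add: inner_vec_def M c_def power2_eq_square mult_ac flip: R_def)
qed

subsection \<open>Strong convexity of spectral functions\<close>

text \<open>The second derivative of \<open>ln\<close> is at most
  \<open>- 1 / \<beta>\<^sup>2\<close> on the interval up to \<open>\<beta>\<close>. Concretely, the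
  derivative of the gap \<open>G\<close> has the sign of \<open>t - a\<close>, because
  \<open>a * t \<le> \<beta>\<^sup>2\<close>, so \<open>G\<close> is minimal at \<open>a\<close>,
  where it vanishes.\<close>

lemma ln_strong_concavity:
  fixes a b \<beta> :: real
  assumes "0 < a" "a \<le> \<beta>" "0 < b" "b \<le> \<beta>"
  shows "ln b \<le> ln a + (b - a) / a - (b - a)\<^sup>2 / (2 * \<beta>\<^sup>2)"
proof -
  define G where "G t = ln a + (t - a) / a - (t - a)\<^sup>2 / (2 * \<beta>\<^sup>2) - ln t" for t
  define G' where "G' t = (t - a) * (1 / (a * t) - 1 / \<beta>\<^sup>2)" for t
  have "\<beta> > 0" using assms by simp
  have deriv: "(G has_real_derivative G' t) (at t)" if "t > 0" for t
    unfolding G_def G'_def using that \<open>a > 0\<close> \<open>\<beta> > 0\<close>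
    by (auto intro!: derivative_eq_intros simp: field_simps power2_eq_square)
  have fac: "0 \<le> 1 / (a * t) - 1 / \<beta>\<^sup>2" if "0 < t" "t \<le> \<beta>" for t
    using that assms by (simp add: frac_le power2_eq_square mult_mono)
  have "G a \<le> G b"
  proof (cases "a \<le> b")
    case True
    show ?thesis
      by (rule DERIV_nonneg_imp_nondecreasing[OF True])
        (use assms fac in \<open>auto intro!: exI[of _ "G' _"] deriv simp: G'_def\<close>)
  next
    case False
    show ?thesis
    proof (rule DERIV_nonpos_imp_nonincreasing[of b a G])
      show "b \<le> a" using False by simp
    qed (use assms fac in \<open>auto intro!: exI[of _ "G' _"] deriv mult_nonpos_nonneg simp: G'_def\<close>)
  qed
  then show ?thesis by (simp add: G_def)
qed

text \<open>For \<open>q = 0\<close> the left-hand side is \<open>ln (det B) - ln (det A)\<close>.\<close>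

lemma sum_UNIV_prod: "sum h UNIV = (\<Sum>i\<in>UNIV. \<Sum>j\<in>UNIV. h (i, j))"
  by (simp add: sum.cartesian_product)

text \<open>The scalar estimate is summed over all pairs of eigenvalues with weights
  \<open>c i j * a $ i powr - q\<close>. In the remainder, \<open>a $ i powr - q\<close> is replaced
  by its lower bound \<open>\<beta> powr - q\<close>; the overlap identities turn the rest into an
  inner product and a norm. The choice \<open>q = 0\<close> serves the determinant,
  \<open>q = p\<close> the trace.\<close>

lemma overlap_ln_sum_le:
  fixes P Q :: "real^'n^'n" and a b :: "real^'n"
  assumes P: "orthogonal_matrix P" and Q: "orthogonal_matrix Q" and "q \<ge> 0"
    and a: "\<And>i. 0 < a $ i" "\<And>i. a $ i \<le> \<beta>" and b: "\<And>j. 0 < b $ j" "\<And>j. b $ j \<le> \<beta>"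
  defines "c \<equiv> \<lambda>i j. ((transpose P ** Q) $ i $ j)\<^sup>2"
    and "M \<equiv> Q ** diag b ** transpose Q - P ** diag a ** transpose P"
  shows "(\<Sum>i\<in>UNIV. \<Sum>j\<in>UNIV. c i j * a $ i powr - q * (ln (b $ j) - ln (a $ i)))
    \<le> (P ** diag (\<chi> i. a $ i powr (- q - 1)) ** transpose P) \<bullet> M
      - \<beta> powr - q / (2 * \<beta>\<^sup>2) * (norm M)\<^sup>2"
proof -
  have "c i j * a $ i powr - q * (ln (b $ j) - ln (a $ i))
      \<le> c i j * a $ i powr (- q - 1) * (b $ j - a $ i)
        - \<beta> powr - q / (2 * \<beta>\<^sup>2) * (c i j * (b $ j - a $ i)\<^sup>2)" for i j
  proof -
    let ?D = "(b $ j - a $ i)\<^sup>2 / (2 * \<beta>\<^sup>2)"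
    have "ln (b $ j) - ln (a $ i) \<le> (b $ j - a $ i) / a $ i - ?D"
      using ln_strong_concavity[OF a(1,2) b(1,2), of j i] by simp
    then have "a $ i powr - q * (ln (b $ j) - ln (a $ i))
        \<le> a $ i powr - q * ((b $ j - a $ i) / a $ i) - a $ i powr - q * ?D"
      by (simp only: right_diff_distrib[symmetric] mult_left_mono powr_ge_zero)
    also have "\<dots> \<le> a $ i powr - q * ((b $ j - a $ i) / a $ i) - \<beta> powr - q * ?D"
      using powr_mono2'[of "- q" "a $ i" \<beta>] a \<open>q \<ge> 0\<close> by (intro diff_left_mono mult_right_mono) auto
    also have "a $ i powr - q * ((b $ j - a $ i) / a $ i) = a $ i powr (- q - 1) * (b $ j - a $ i)"
      using a(1)[of i] by (simp add: powr_diff)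
    finally have "c i j * (a $ i powr - q * (ln (b $ j) - ln (a $ i)))
        \<le> c i j * (a $ i powr (- q - 1) * (b $ j - a $ i) - \<beta> powr - q * ?D)"
      by (rule mult_left_mono) (simp add: c_def)
    then show ?thesis by (simp add: algebra_simps)
  qed
  then have "(\<Sum>i\<in>UNIV. \<Sum>j\<in>UNIV. c i j * a $ i powr - q * (ln (b $ j) - ln (a $ i)))
     \<le> (\<Sum>i\<in>UNIV. \<Sum>j\<in>UNIV. c i j * a $ i powr (- q - 1) * (b $ j - a $ i)
        - \<beta> powr - q / (2 * \<beta>\<^sup>2) * (c i j * (b $ j - a $ i)\<^sup>2))"
    by (intro sum_mono)
  also have "\<dots> = (P ** diag (\<chi> i. a $ i powr (- q - 1)) ** transpose P) \<bullet> M
      - \<beta> powr - q / (2 * \<beta>\<^sup>2) * (norm M)\<^sup>2"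
    unfolding M_def overlap_inner[OF P Q] overlap_norm[OF P Q] c_def
    by (simp add: sum_subtractf sum_distrib_left)
  finally show ?thesis .
qed

section \<open>Gradient inequalities for the log-determinant and the log-trace\<close>

lemma pos_def_eigendecomposition:
  fixes M :: "real^'n^'n"
  assumes "pos_def M"
  obtains Q d where "orthogonal_matrix Q" "M = Q ** diag d ** transpose Q"
    "\<And>i. 0 < d $ i" "\<And>i. d $ i \<le> norm M"
proof -
  obtain Q d where Q: "orthogonal_matrix Q" "M = Q ** diag d ** transpose Q"
    using assms symmetric_matrix_eigendecomposition unfolding pos_def_def by blast
  moreover have "0 < d $ i" for i
    using pos_def_eigenvalues_pos[OF Q(1)] assms Q(2) by blast
  moreover have "d $ i \<le> norm M" for i
    using norm_eigendecomposition[OF Q(1), of d i] Q(2) by simp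
  ultimately show ?thesis using that by blast
qed

lemma trace_matrix_powr_pos:
  fixes M :: "real^'n^'n"
  assumes "pos_def M"
  shows "0 < trace (matrix_powr M q)"
proof -
  obtain Q d where Q: "orthogonal_matrix Q" "M = Q ** diag d ** transpose Q" and d: "\<And>i. 0 < d $ i"
    using pos_def_eigendecomposition[OF assms] by metis
  have "0 < d $ i powr q" for i using d[of i] by simp
  then show ?thesis
    by (simp add: Q matrix_powr_eigendecomposition trace_eigendecomposition sum_pos)
qed

lemma ln_det_strong_concavity:
  fixes A :: "real^'n^'n"
  assumes "pos_def A" "norm A \<le> \<beta>"
  shows "\<exists>G. \<forall>B. pos_def B \<and> norm B \<le> \<beta> \<longrightarrow>
    - ln (det A) + G \<bullet> (B - A) + 1 / (2 * \<beta>\<^sup>2) * (norm (B - A))\<^sup>2 \<le> - ln (det B)"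
proof -
  obtain P a where P: "orthogonal_matrix P" "A = P ** diag a ** transpose P"
    and a: "\<And>i. 0 < a $ i" "\<And>i. a $ i \<le> norm A"
    using pos_def_eigendecomposition[OF assms(1)] by blast
  \<comment> \<open>This is the inverse of \<open>A\<close>, the gradient of \<open>ln det\<close>
    at \<open>A\<close>; the exponent is spelled to match \<open>overlap_ln_sum_le\<close> at
    \<open>q = 0\<close>.\<close>
  define G where "G = P ** diag (\<chi> i. a $ i powr (- 0 - 1)) ** transpose P"
  have "ln (det B) \<le> ln (det A) + G \<bullet> (B - A) - 1 / (2 * \<beta>\<^sup>2) * (norm (B - A))\<^sup>2"
    if "pos_def B" and "norm B \<le> \<beta>" for B
  proof -
    obtain Q b where Q: "orthogonal_matrix Q" "B = Q ** diag b ** transpose Q"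
      and b: "\<And>i. 0 < b $ i" "\<And>i. b $ i \<le> norm B"
      using pos_def_eigendecomposition[OF \<open>pos_def B\<close>] by blast
    define c where "c i j = ((transpose P ** Q) $ i $ j)\<^sup>2" for i j
    have c: "(\<Sum>j\<in>UNIV. c i j) = 1" "(\<Sum>i\<in>UNIV. c i j) = 1" for i j
      unfolding c_def using overlap_sum_row overlap_sum_column P(1) Q(1) by blast+
    have "ln (det B) - ln (det A) = (\<Sum>j\<in>UNIV. ln (b $ j)) - (\<Sum>i\<in>UNIV. ln (a $ i))"
      using a(1) b(1) by (simp add: P Q det_eigendecomposition ln_prod less_imp_neq[symmetric] less_imp_neq)
    \<comment> \<open>Rows and columns of \<open>c\<close> sum to 1, so both single sums can be
      spread over pairs with the same weights.\<close>
    also have "(\<Sum>j\<in>UNIV. ln (b $ j)) = (\<Sum>i\<in>UNIV. \<Sum>j\<in>UNIV. c i j * ln (b $ j))"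
      by (subst sum.swap) (simp add: c flip: sum_distrib_right)
    also have "(\<Sum>i\<in>UNIV. ln (a $ i)) = (\<Sum>i\<in>UNIV. \<Sum>j\<in>UNIV. c i j * ln (a $ i))"
      by (simp add: c flip: sum_distrib_right)
    also have "(\<Sum>i\<in>UNIV. \<Sum>j\<in>UNIV. c i j * ln (b $ j)) - (\<Sum>i\<in>UNIV. \<Sum>j\<in>UNIV. c i j * ln (a $ i))
        = (\<Sum>i\<in>UNIV. \<Sum>j\<in>UNIV. c i j * a $ i powr - 0 * (ln (b $ j) - ln (a $ i)))"
      using a(1) by (simp add: sum_subtractf right_diff_distrib less_imp_neq[symmetric])
    also have "\<dots> \<le> G \<bullet> (B - A) - \<beta> powr - 0 / (2 * \<beta>\<^sup>2) * (norm (B - A))\<^sup>2"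
      unfolding c_def G_def P(2) Q(2)
      using order_trans[OF a(2) assms(2)] order_trans[OF b(2) that(2)]
      by (intro overlap_ln_sum_le P Q a b) (auto simp flip: P(2) Q(2))
    also have "\<beta> powr - 0 = 1"
      using less_le_trans[OF a(1) order_trans[OF a(2) assms(2)]] by simp
    finally show ?thesis by simp
  qed
  then show ?thesis by (intro exI[of _ "- G"]) force
qed

text \<open>The factor \<open>trace (matrix_powr A (- p))\<close> is kept on the right so that one
  inequality serves two objectives: dividing by it yields the logarithm of the trace, and
  \<open>ln t \<le> t - 1\<close> yields the trace itself.\<close>

lemma ln_trace_powr_strong_convexity:
  fixes A :: "real^'n^'n"
  assumes "pos_def A" "norm A \<le> \<beta>" "p > 0"
  shows "\<exists>G. \<forall>B. pos_def B \<and> norm B \<le> \<beta> \<longrightarrow>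
    G \<bullet> (B - A) + p * (\<beta> powr - p / (2 * \<beta>\<^sup>2)) * (norm (B - A))\<^sup>2
      \<le> trace (matrix_powr A (- p)) * (ln (trace (matrix_powr B (- p))) - ln (trace (matrix_powr A (- p))))"
proof -
  obtain P a where P: "orthogonal_matrix P" "A = P ** diag a ** transpose P"
    and a: "\<And>i. 0 < a $ i" "\<And>i. a $ i \<le> norm A"
    using pos_def_eigendecomposition[OF assms(1)] by blast
  \<comment> \<open>Up to the factor \<open>- p\<close>, this is the gradient of the trace of the
    \<open>- p\<close>-th power at \<open>A\<close>.\<close>
  define G where "G = P ** diag (\<chi> i. a $ i powr (- p - 1)) ** transpose P"
  define S where "S = trace (matrix_powr A (- p))"
  have "S > 0" using assms(1) by (simp add: S_def trace_matrix_powr_pos)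
  have S: "S = (\<Sum>i\<in>UNIV. a $ i powr - p)"
    using P by (simp add: S_def matrix_powr_eigendecomposition trace_eigendecomposition)
  have "(- p *\<^sub>R G) \<bullet> (B - A) + p * (\<beta> powr - p / (2 * \<beta>\<^sup>2)) * (norm (B - A))\<^sup>2
      \<le> S * (ln (trace (matrix_powr B (- p))) - ln S)"
    if "pos_def B" and "norm B \<le> \<beta>" for B
  proof -
    obtain Q b where Q: "orthogonal_matrix Q" "B = Q ** diag b ** transpose Q"
      and b: "\<And>i. 0 < b $ i" "\<And>i. b $ i \<le> norm B"
      using pos_def_eigendecomposition[OF \<open>pos_def B\<close>] by blast
    define c where "c i j = ((transpose P ** Q) $ i $ j)\<^sup>2" for i j
    have c: "(\<Sum>j\<in>UNIV. c i j) = 1" "(\<Sum>i\<in>UNIV. c i j) = 1" for i j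
      unfolding c_def using overlap_sum_row overlap_sum_column P(1) Q(1) by blast+
    define T where "T = trace (matrix_powr B (- p))"
    have "T > 0" using that by (simp add: T_def trace_matrix_powr_pos)
    have T: "T = (\<Sum>i\<in>UNIV. b $ i powr - p)"
      using Q by (simp add: T_def matrix_powr_eigendecomposition trace_eigendecomposition)
    \<comment> \<open>The \<open>w\<close> are probability weights on pairs, chosen so that the mean
      of the ratios \<open>r\<close> is \<open>T / S\<close>. Jensen's inequality then bounds
      \<open>ln T - ln S\<close> from below by the mean of \<open>ln r\<close>.\<close>
    define w where "w = (\<lambda>(i, j). c i j * a $ i powr - p / S)"
    define r where "r = (\<lambda>(i :: 'n, j). (b $ j / a $ i) powr - p)"
    have apos: "a $ i \<noteq> 0" for i using a(1)[of i] by simp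
    have "sum w UNIV = (\<Sum>i\<in>UNIV. (\<Sum>j\<in>UNIV. c i j) * a $ i powr - p) / S"
      by (simp add: sum_UNIV_prod w_def sum_divide_distrib sum_distrib_right)
    also have "\<dots> = 1" using \<open>S > 0\<close> by (simp add: c S)
    finally have "sum w UNIV = 1" .
    have "w (i, j) * r (i, j) = c i j * b $ j powr - p / S" for i j
      using apos[of i] a(1)[of i] b(1)[of j] by (simp add: w_def r_def powr_divide less_imp_le)
    then have "(\<Sum>x\<in>UNIV. w x * r x) = (\<Sum>i\<in>UNIV. \<Sum>j\<in>UNIV. c i j * b $ j powr - p / S)"
      by (simp add: sum_UNIV_prod)
    also have "\<dots> = T / S"
      by (subst sum.swap) (simp add: c T flip: sum_distrib_right sum_divide_distrib)
    finally have wr: "(\<Sum>x\<in>UNIV. w x * r x) = T / S" .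
    have "(\<Sum>x\<in>UNIV. w x * ln (r x)) \<le> ln (\<Sum>x\<in>UNIV. w x *\<^sub>R r x)"
    proof (rule concave_on_sum)
      show "concave_on {0<..} (ln :: real \<Rightarrow> real)" by (rule ln_concave)
      show "r x \<in> {0<..}" for x
        using a(1)[of "fst x"] b(1)[of "snd x"] by (simp add: r_def case_prod_unfold)
      show "0 \<le> w x" for x
        using \<open>S > 0\<close> by (simp add: w_def c_def case_prod_unfold)
    qed (use \<open>sum w UNIV = 1\<close> in auto)
    also have "\<dots> = ln T - ln S"
      using \<open>S > 0\<close> \<open>T > 0\<close> by (simp add: wr ln_div)
    finally have "S * (\<Sum>x\<in>UNIV. w x * ln (r x)) \<le> S * (ln T - ln S)"
      using \<open>S > 0\<close> by simp
    \<comment> \<open>Each \<open>ln (r (i, j))\<close> is \<open>- p\<close> times a difference of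
      logarithms of eigenvalues. The negative factor reverses the upper bound of
      \<open>overlap_ln_sum_le\<close> into the lower bound wanted here.\<close>
    moreover have "S * (w (i, j) * ln (r (i, j))) = - p * (c i j * a $ i powr - p * (ln (b $ j) - ln (a $ i)))" for i j
      using a(1)[of i] b(1)[of j] \<open>S > 0\<close> by (simp add: w_def r_def ln_powr ln_div)
    then have "S * (\<Sum>x\<in>UNIV. w x * ln (r x))
        = - p * (\<Sum>i\<in>UNIV. \<Sum>j\<in>UNIV. c i j * a $ i powr - p * (ln (b $ j) - ln (a $ i)))"
      by (simp only: sum_distrib_left sum_UNIV_prod)
    moreover have "(\<Sum>i\<in>UNIV. \<Sum>j\<in>UNIV. c i j * a $ i powr - p * (ln (b $ j) - ln (a $ i)))
        \<le> G \<bullet> (B - A) - \<beta> powr - p / (2 * \<beta>\<^sup>2) * (norm (B - A))\<^sup>2"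
      unfolding c_def G_def P(2) Q(2)
      using order_trans[OF a(2) assms(2)] order_trans[OF b(2) that(2)] \<open>p > 0\<close>
      by (intro overlap_ln_sum_le P Q a b) (auto simp flip: P(2) Q(2))
    then have "- p * (G \<bullet> (B - A) - \<beta> powr - p / (2 * \<beta>\<^sup>2) * (norm (B - A))\<^sup>2)
        \<le> - p * (\<Sum>i\<in>UNIV. \<Sum>j\<in>UNIV. c i j * a $ i powr - p * (ln (b $ j) - ln (a $ i)))"
      using \<open>p > 0\<close> by simp
    ultimately have "- p * (G \<bullet> (B - A) - \<beta> powr - p / (2 * \<beta>\<^sup>2) * (norm (B - A))\<^sup>2) \<le> S * (ln T - ln S)"
      by simp
    then show ?thesis by (simp add: T_def algebra_simps)
  qed
  then show ?thesis unfolding S_def by blast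
qed

subsection \<open>Information matrices\<close>

text \<open>The \<open>l\<close> part of \<open>diag (x - l)\<close> cancels the offset, so the
  fusion objectives need no separate treatment.\<close>

lemma fusion_info_matrix_eq: "fusion_info_matrix A l x = info_matrix A x"
proof -
  have "diag (x - l) = diag x - diag l"
    by (simp add: diag_def vec_eq_iff)
  then show ?thesis
    by (simp add: fusion_info_matrix_def info_matrix_def matrix_mult_diff_sandwich)
qed

lemma linear_info_matrix: "linear (info_matrix A)"
proof (rule linearI)
  show "info_matrix A (x + y) = info_matrix A x + info_matrix A y" for x y
    by (simp add: info_matrix_def vec_eq_iff matrix_matrix_mult_def diag_def algebra_simps sum.distrib
        if_distrib[of "\<lambda>z. _ * z"] cong: if_cong)
  show "info_matrix A (c *\<^sub>R x) = c *\<^sub>R info_matrix A x" for c x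
    by (simp add: info_matrix_def vec_eq_iff matrix_matrix_mult_def diag_def algebra_simps sum_distrib_left
        if_distrib[of "\<lambda>z. _ * z"] cong: if_cong)
qed

lemma convex_pos_def: "convex {M. pos_def M}"
proof (rule convexI, clarify)
  fix M M' :: "real^'n^'n" and s t :: real
  assume M: "pos_def M" "pos_def M'" and st: "0 \<le> s" "0 \<le> t" "s + t = 1"
  have "transpose (s *\<^sub>R M + t *\<^sub>R M') = s *\<^sub>R M + t *\<^sub>R M'"
    using M by (simp add: pos_def_def transpose_def vec_eq_iff)
  moreover have "0 < x \<bullet> ((s *\<^sub>R M + t *\<^sub>R M') *v x)" if "x \<noteq> 0" for x
  proof -
    have "0 < x \<bullet> (M *v x)" "0 < x \<bullet> (M' *v x)"
      using M that by (auto simp: pos_def_def)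
    moreover have "s > 0 \<or> t > 0" using st by linarith
    ultimately have "0 < s * (x \<bullet> (M *v x)) + t * (x \<bullet> (M' *v x))"
      using st by (meson add_nonneg_pos add_pos_nonneg less_imp_le mult_nonneg_nonneg mult_pos_pos)
    then show ?thesis
      by (simp add: matrix_vector_mult_add_rdistrib inner_add_right flip: scaleR_matrix_vector_assoc)
  qed
  ultimately show "pos_def (s *\<^sub>R M + t *\<^sub>R M')"
    by (simp add: pos_def_def)
qed

text \<open>Nonnegative coordinates with sum \<open>N\<close> are at most \<open>N\<close>, which
  leaves finitely many natural vectors. This makes the feasible hull a polytope.\<close>

lemma finite_feasible_vertices:
  fixes A :: "real^'n^'m"
  shows "finite (design_polytope l u N \<inter> info_domain A \<inter> nat_vecs)"
proof -
  have "{x :: real^'m. \<forall>i. x $ i \<in> real ` {..N}} \<subseteq> vec_lambda ` (UNIV \<rightarrow>\<^sub>E real ` {..N})"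
    by (auto intro!: image_eqI[of _ vec_lambda "vec_nth _"])
  then have "finite {x :: real^'m. \<forall>i. x $ i \<in> real ` {..N}}"
    by (rule finite_subset) (simp add: finite_PiE)
  moreover have "x $ i \<in> real ` {..N}" if "x \<in> design_polytope l u N" "x \<in> nat_vecs" for x :: "real^'m" and i
  proof -
    obtain k where k: "x $ i = real k"
      using \<open>x \<in> nat_vecs\<close> by (auto simp: nat_vecs_def Nats_def)
    have "x $ i \<le> (\<Sum>i\<in>UNIV. x $ i)"
      using that by (intro member_le_sum) (auto simp: design_polytope_def)
    with k that show ?thesis by (simp add: design_polytope_def)
  qed
  ultimately show ?thesis
    by (auto elim!: rev_finite_subset)
qed

text \<open>Positive definiteness holds at the generating points and passes to their hull, as the
  preimage of a convex set under a linear map is convex.\<close>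

lemma pos_def_feasible_hull:
  assumes "x \<in> feasible_hull A l u N"
  shows "pos_def (info_matrix A x)"
proof -
  have "feasible_hull A l u N \<subseteq> info_matrix A -` {M. pos_def M}"
    unfolding feasible_hull_def
    by (intro hull_minimal convex_linear_vimage linear_info_matrix convex_pos_def)
      (auto simp: info_domain_def)
  with assms show ?thesis by blast
qed

section \<open>Sharpness of the three objectives on the feasible hull\<close>

lemma
  fixes A :: "real^'n^'m" and l u :: "real^'m" and N :: nat and p :: real
  assumes "p > 0"
  defines "W \<equiv> feasible_hull A l u N"
  shows sharp_ln_det: "\<exists>c>0. sharp_on W (\<lambda>x. - ln (det (info_matrix A x))) c (1/2)"
    and sharp_trace_powr: "\<exists>c>0. sharp_on W (\<lambda>x. trace (matrix_powr (info_matrix A x) (- p))) c (1/2)"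
    and sharp_ln_trace_powr: "\<exists>c>0. sharp_on W (\<lambda>x. ln (trace (matrix_powr (info_matrix A x) (- p)))) c (1/2)"
proof -
  define V where "V = design_polytope l u N \<inter> info_domain A \<inter> nat_vecs"
  have "finite V" unfolding V_def by (rule finite_feasible_vertices)
  have W: "W = convex hull V" by (simp add: W_def V_def feasible_hull_def)
  have poly: "polytope W" using \<open>finite V\<close> W by (auto simp: polytope_def)
  have pd: "pos_def (info_matrix A x)" if "x \<in> W" for x
    using that unfolding W_def by (rule pos_def_feasible_hull)
  have "compact (info_matrix A ` W)"
    using poly linear_continuous_on linear_info_matrix linear_conv_bounded_linear
    by (blast intro: compact_continuous_image polytope_imp_compact)
  \<comment> \<open>One bound for all information matrices over \<open>W\<close> makes the strong
    convexity constants uniform.\<close>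
  then obtain \<beta> where "\<beta> > 0" and \<beta>: "\<And>x. x \<in> W \<Longrightarrow> norm (info_matrix A x) \<le> \<beta>"
    using compact_imp_bounded bounded_pos by (metis image_eqI)
  show "\<exists>c>0. sharp_on W (\<lambda>x. - ln (det (info_matrix A x))) c (1/2)"
  proof (rule sharp_on_half(2)[OF poly linear_info_matrix[of A]])
    show "0 < 1 / (2 * \<beta>\<^sup>2)" using \<open>\<beta> > 0\<close> by simp
  qed (use ln_det_strong_concavity pd \<beta> in meson)
  define S where "S x = trace (matrix_powr (info_matrix A x) (- p))" for x
  have S: "S x > 0" if "x \<in> W" for x
    using pd[OF that] by (simp add: S_def trace_matrix_powr_pos)
  define k where "k = p * (\<beta> powr - p / (2 * \<beta>\<^sup>2))"
  have "k > 0" using \<open>\<beta> > 0\<close> \<open>p > 0\<close> by (simp add: k_def)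
  have G: "\<exists>G. \<forall>y\<in>W. G \<bullet> (info_matrix A y - info_matrix A x) + k * (norm (info_matrix A y - info_matrix A x))\<^sup>2
      \<le> S x * (ln (S y) - ln (S x))" if "x \<in> W" for x
    using ln_trace_powr_strong_convexity[OF pd[OF that] \<beta>[OF that] \<open>p > 0\<close>] pd \<beta>
    unfolding S_def k_def by meson
  have "\<exists>G. \<forall>y\<in>W. S x + G \<bullet> (info_matrix A y - info_matrix A x) + k * (norm (info_matrix A y - info_matrix A x))\<^sup>2
      \<le> S y" if x: "x \<in> W" for x
  proof -
    have "S x * (ln (S y) - ln (S x)) \<le> S y - S x" if y: "y \<in> W" for y
    proof -
      have "ln (S y / S x) \<le> S y / S x - 1"
        using S[OF x] S[OF y] by (intro ln_le_minus_one) simp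
      then show ?thesis
        using S[OF x] S[OF y] by (simp add: ln_div field_simps)
    qed
    then show ?thesis
      using G[OF x] by (smt (verit))
  qed
  note S_sharp = sharp_on_half[OF poly linear_info_matrix \<open>k > 0\<close> this]
  show "\<exists>c>0. sharp_on W (\<lambda>x. trace (matrix_powr (info_matrix A x) (- p))) c (1/2)"
    using S_sharp(2) unfolding S_def .
  \<comment> \<open>By convexity of \<open>S\<close>, just established, a bound at the points of
    \<open>V\<close> holds on the whole hull. Inserting 1 makes the maximum meaningful for empty
    \<open>V\<close> and \<open>\<sigma>\<close> positive.\<close>
  define \<sigma> where "\<sigma> = Max (insert 1 (S ` V))"
  have "\<sigma> > 0" using \<open>finite V\<close> by (simp add: \<sigma>_def less_le_trans[OF zero_less_one])
  have "\<forall>x\<in>V. S x \<le> \<sigma>" using \<open>finite V\<close> by (simp add: \<sigma>_def)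
  then have \<sigma>: "S x \<le> \<sigma>" if "x \<in> W" for x
    using convex_on_convex_hull_bound S_sharp(1) that unfolding W by blast
  have "\<exists>G. \<forall>y\<in>W. ln (S x) + G \<bullet> (info_matrix A y - info_matrix A x) + k / \<sigma> * (norm (info_matrix A y - info_matrix A x))\<^sup>2
      \<le> ln (S y)" if x: "x \<in> W" for x
  proof -
    obtain G where G: "\<And>y. y \<in> W \<Longrightarrow> G \<bullet> (info_matrix A y - info_matrix A x)
        + k * (norm (info_matrix A y - info_matrix A x))\<^sup>2 \<le> S x * (ln (S y) - ln (S x))"
      using G[OF x] by blast
    \<comment> \<open>Division by \<open>S x\<close> rescales the subgradient and gives the
      quadratic coefficient \<open>k / S x\<close>, which depends on \<open>x\<close>;
      \<open>\<sigma>\<close> replaces it by a uniform one.\<close>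
    have "ln (S x) + (G /\<^sub>R S x) \<bullet> (info_matrix A y - info_matrix A x)
        + k / \<sigma> * (norm (info_matrix A y - info_matrix A x))\<^sup>2 \<le> ln (S y)" if y: "y \<in> W" for y
    proof -
      have "k / \<sigma> * (norm (info_matrix A y - info_matrix A x))\<^sup>2
          \<le> k / S x * (norm (info_matrix A y - info_matrix A x))\<^sup>2"
        using \<sigma>[OF x] S[OF x] \<open>k > 0\<close> by (intro mult_right_mono divide_left_mono) auto
      moreover have "(G \<bullet> (info_matrix A y - info_matrix A x)
        + k * (norm (info_matrix A y - info_matrix A x))\<^sup>2) / S x \<le> ln (S y) - ln (S x)"
        using G[OF y] S[OF x] by (simp add: pos_divide_le_eq mult.commute)
      ultimately show ?thesis
        by (simp add: divide_inverse_commute distrib_left mult.assoc)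
    qed
    then show ?thesis by blast
  qed
  from sharp_on_half(2)[OF poly linear_info_matrix _ this] \<open>k > 0\<close> \<open>\<sigma> > 0\<close>
  show "\<exists>c>0. sharp_on W (\<lambda>x. ln (trace (matrix_powr (info_matrix A x) (- p)))) c (1/2)"
    unfolding S_def by simp
qed

theorem theorem5:
  fixes A :: "real^'n^'m" and l u :: "real^'m" and N :: nat and p :: real
  assumes "rank A = CARD('n)"
    and "l \<in> nat_vecs" and "u \<in> nat_vecs" and "l \<le> u"
    and "N > 0" and "p > 0"
  defines "W \<equiv> feasible_hull A l u N"
  shows "(l = 0 \<longrightarrow>
      (\<exists>c>0. sharp_on W (\<lambda>x. - ln (det (info_matrix A x))) c (1/2)) \<and>
      (\<exists>c>0. sharp_on W (\<lambda>x. trace (matrix_powr (info_matrix A x) (- p))) c (1/2)) \<and>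
      (\<exists>c>0. sharp_on W (\<lambda>x. ln (trace (matrix_powr (info_matrix A x) (- p)))) c (1/2))) \<and>
    (fusion_bounds A l \<longrightarrow>
      (\<exists>c>0. sharp_on W (\<lambda>x. - ln (det (fusion_info_matrix A l x))) c (1/2)) \<and>
      (\<exists>c>0. sharp_on W (\<lambda>x. trace (matrix_powr (fusion_info_matrix A l x) (- p))) c (1/2)) \<and>
      (\<exists>c>0. sharp_on W (\<lambda>x. ln (trace (matrix_powr (fusion_info_matrix A l x) (- p)))) c (1/2)))"
  unfolding W_def fusion_info_matrix_eq
  using sharp_ln_det sharp_trace_powr[OF \<open>p > 0\<close>] sharp_ln_trace_powr[OF \<open>p > 0\<close>] by blast

end
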